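(* Let $T=p(z)D_{zz}+q(z)D_z+r(z)$ be an exceptional operator and let $\zeta\in\mathbb C$. If $p(\zeta)\neq0$, then $T$ has trivial monodromy at $z=\zeta$.
   Context: $\mathbb N=\{0,1,2,\ldots\}$. Coefficients $p,q,r\in\mathbb C(z)$ with $p\neq0$. $T$ is exceptional if there is a finite set $\{k_1,\ldots,k_m\}\subset\mathbb N$ ($m=0$ allowed) such that for every $k\in\mathbb N\setminus\{k_1,\ldots,k_m\}$ there is a polynomial $y_k\in\mathbb C[z]$ of degree exactly $k$ and $\lambda_k\in\mathbb C$ with $T[y_k]=\lambda_ky_k$, and no such polynomial exists for $k\in\{k_1,\ldots,k_m\}$. (For an exceptional operator $p$ is a polynomial.) $T$ has trivial monodromy at $\zeta$ if $T[y]=0$ admits two linearly independent Laurent series solutions at $\zeta$, i.e. the general solution of $T[y]=0$ is meromorphic in a neighbourhood of $\zeta$. *)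

theory Defs
  imports "HOL-Complex_Analysis.Complex_Analysis"
    "HOL-Computational_Algebra.Computational_Algebra"
    "HOL-Computational_Algebra.Field_as_Ring"
begin

text \<open>
  The field \<open>\<complex>(z)\<close> is \<^typ>\<open>complex poly fract\<close>. The fraction returned by
  \<^const>\<open>quot_of_fract\<close> is in lowest terms, so a rational function is regular at \<open>\<zeta>\<close>
  iff the denominator does not vanish there. At a pole the value below is the junk value 0;
  hence \<open>ratfun_eval f \<zeta> \<noteq> 0\<close> says that \<open>f\<close> is regular at \<open>\<zeta>\<close> with nonzero value.
\<close>

definition ratfun_eval :: "complex poly fract \<Rightarrow> complex \<Rightarrow> complex" where
  "ratfun_eval f \<zeta> = poly (fst (quot_of_fract f)) \<zeta> / poly (snd (quot_of_fract f)) \<zeta>"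

text \<open>The Laurent series of a rational function at \<open>\<zeta>\<close>, in the local variable \<open>z - \<zeta>\<close>.\<close>

definition poly_laurent :: "complex \<Rightarrow> complex poly \<Rightarrow> complex fls" where
  "poly_laurent \<zeta> f = fps_to_fls (fps_of_poly (pcompose f [:\<zeta>, 1:]))"

definition ratfun_laurent :: "complex \<Rightarrow> complex poly fract \<Rightarrow> complex fls" where
  "ratfun_laurent \<zeta> f =
     poly_laurent \<zeta> (fst (quot_of_fract f)) / poly_laurent \<zeta> (snd (quot_of_fract f))"

text \<open>The operator \<open>T = p D\<^sub>z\<^sub>z + q D\<^sub>z + r\<close>, acting on polynomials (with values in \<open>\<complex>(z)\<close>)
  and on Laurent series at \<open>\<zeta>\<close>.\<close>

definition op_poly ::
  "complex poly fract \<Rightarrow> complex poly fract \<Rightarrow> complex poly fract \<Rightarrow> complex poly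
    \<Rightarrow> complex poly fract" where
  "op_poly p q r y =
     p * to_fract (pderiv (pderiv y)) + q * to_fract (pderiv y) + r * to_fract y"

definition op_laurent ::
  "complex poly fract \<Rightarrow> complex poly fract \<Rightarrow> complex poly fract \<Rightarrow> complex
    \<Rightarrow> complex fls \<Rightarrow> complex fls" where
  "op_laurent p q r \<zeta> F =
     ratfun_laurent \<zeta> p * fls_deriv (fls_deriv F) + ratfun_laurent \<zeta> q * fls_deriv F
       + ratfun_laurent \<zeta> r * F"

text \<open>The conjunct \<open>y \<noteq> 0\<close> is needed because \<^prop>\<open>degree (0 :: complex poly) = 0\<close>.\<close>

definition has_eigenpoly ::
  "complex poly fract \<Rightarrow> complex poly fract \<Rightarrow> complex poly fract \<Rightarrow> nat \<Rightarrow> bool" where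
  "has_eigenpoly p q r k \<longleftrightarrow>
     (\<exists>y c. y \<noteq> 0 \<and> degree y = k \<and> op_poly p q r y = to_fract (smult c y))"

definition exceptional ::
  "complex poly fract \<Rightarrow> complex poly fract \<Rightarrow> complex poly fract \<Rightarrow> bool" where
  "exceptional p q r \<longleftrightarrow>
     p \<noteq> 0 \<and>
     (\<exists>K. finite K \<and> (\<forall>k. k \<notin> K \<longrightarrow> has_eigenpoly p q r k)
                  \<and> (\<forall>k\<in>K. \<not> has_eigenpoly p q r k))"

text \<open>
  A Laurent series solution is required to converge in a punctured disc about \<open>\<zeta>\<close>, so that
  it is the expansion of a function meromorphic near \<open>\<zeta>\<close>; as the solution space has
  dimension two, the general solution is then meromorphic near \<open>\<zeta>\<close>.
\<close>

definition laurent_solution ::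
  "complex poly fract \<Rightarrow> complex poly fract \<Rightarrow> complex poly fract \<Rightarrow> complex
    \<Rightarrow> complex fls \<Rightarrow> bool" where
  "laurent_solution p q r \<zeta> F \<longleftrightarrow> fls_conv_radius F > 0 \<and> op_laurent p q r \<zeta> F = 0"

definition trivial_monodromy ::
  "complex poly fract \<Rightarrow> complex poly fract \<Rightarrow> complex poly fract \<Rightarrow> complex \<Rightarrow> bool" where
  "trivial_monodromy p q r \<zeta> \<longleftrightarrow>
     (\<exists>F G. laurent_solution p q r \<zeta> F \<and> laurent_solution p q r \<zeta> G \<and>
        (\<forall>a b. fls_const a * F + fls_const b * G = 0 \<longrightarrow> a = 0 \<and> b = 0))"

lemma ratfun_eval_to_fract: "ratfun_eval (to_fract f) \<zeta> = poly f \<zeta>"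
  by (simp add: ratfun_eval_def)

lemma poly_laurent_expansion:
  "(\<lambda>z. poly f (\<zeta> + z)) has_laurent_expansion poly_laurent \<zeta> f"
proof -
  have "eval_fps (fps_of_poly (pcompose f [:\<zeta>, 1:])) = (\<lambda>z. poly f (\<zeta> + z))"
    by (auto simp: poly_pcompose)
  moreover have "eval_fps (fps_of_poly (pcompose f [:\<zeta>, 1:])) has_fps_expansion
      fps_of_poly (pcompose f [:\<zeta>, 1:])"
    by (rule eval_fps_has_fps_expansion) simp
  ultimately show ?thesis
    unfolding poly_laurent_def by (metis has_laurent_expansion_fps)
qed

lemma ratfun_laurent_expansion:
  "(\<lambda>z. ratfun_eval f (\<zeta> + z)) has_laurent_expansion ratfun_laurent \<zeta> f"
  unfolding ratfun_eval_def ratfun_laurent_def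
  by (intro has_laurent_expansion_divide poly_laurent_expansion)

end

theory Submission
  imports Defs
begin

text \<open>
  Let \<open>U\<close> be the span of the polynomial eigenfunctions of \<open>T\<close>. It is \<open>T\<close>-stable, and since
  eigenpolynomials of all but finitely many degrees exist, it has finite codimension in the
  polynomials. Finite codimension is also visible at \<open>\<zeta>\<close>: the set \<open>I\<close> of orders of vanishing at
  \<open>\<zeta>\<close> of the nonzero elements of \<open>U\<close> misses only finitely many natural numbers
  (\<open>finite_missing_orders\<close>). The rest of the proof confronts this with the way in which \<open>T\<close>
  changes the order at \<open>\<zeta>\<close>.

  Let \<open>s\<close> be the least integer \<open>\<ge> 2\<close> such that \<open>T\<close> lowers orders by at most \<open>s\<close>. On leading terms
  \<open>T\<close> acts by \<open>(z - \<zeta>) ^ n \<mapsto> f(n) * (z - \<zeta>) ^ (n - s)\<close> with a nonzero polynomial \<open>f\<close> of degree at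
  most 2. Hence \<open>n \<in> I\<close> implies \<open>n - s \<in> I\<close> unless \<open>f(n) = 0\<close>. As orders are nonnegative, this
  descent has to stop in each of the \<open>s\<close> residue classes modulo \<open>s\<close>, and it can only stop at a
  root of \<open>f\<close>. So \<open>s \<le> 2\<close>, which means that \<open>\<zeta>\<close> is at worst a regular singular point
  (\<open>fuchsian\<close>), and the two roots of \<open>f\<close>, now the exponents, are the smallest even and the
  smallest odd element of \<open>I\<close> (\<open>indicial_exponents\<close>). It follows that
  \<open>I = {M, M + 2, \<dots>} \<union> {N, N + 2, \<dots>}\<close> where \<open>M < N\<close> are the exponents.

  Frobenius' method always gives a solution of order \<open>N\<close>. A solution of order \<open>M\<close> may fail to exist
  because the recursion is obstructed at the exponent \<open>N\<close>, where a logarithm would enter. Here the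
  obstruction vanishes: start with some \<open>v \<in> U\<close> of order \<open>M\<close>. The order \<open>m\<close> of \<open>T v\<close> lies in \<open>I\<close>,
  since \<open>T v \<in> U\<close>. Then \<open>m + 2 \<in> I\<close>, and \<open>m + 2\<close> is not an exponent, since \<open>N - 2 \<notin> I\<close>. So a
  multiple of an element of \<open>U\<close> of order \<open>m + 2\<close> removes the leading term of \<open>T v\<close>. After finitely
  many such steps \<open>T v\<close> vanishes to an order beyond \<open>N - 2\<close> (\<open>approximate_solution\<close>), and from there
  on the recursion is unobstructed: the equation \<open>T w = T v\<close> has a convergent solution \<open>w\<close> of order
  greater than \<open>N\<close> (\<open>frobenius_solution_laurent\<close>), and \<open>v - w\<close> is a solution of order \<open>M\<close>.
\<close>

unbundle no vec_syntax
unbundle Formal_Power_Series.fps_syntax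
unbundle fps_syntax

section \<open>Orders of vanishing in a space of polynomials of finite codimension\<close>

interpretation poly_space: vector_space "smult :: 'a :: field \<Rightarrow> 'a poly \<Rightarrow> 'a poly"
  by unfold_locales (simp_all add: smult_add_right smult_add_left)

lemma subspace_all_degrees_eq_UNIV:
  fixes U :: "'a :: field poly set"
  assumes U: "poly_space.subspace U"
    and deg: "\<And>k. \<exists>u\<in>U. u \<noteq> 0 \<and> degree u = k"
  shows "f \<in> U"
proof (induction "degree f" arbitrary: f rule: less_induct)
  case less
  show ?case
  proof (cases "f = 0")
    case True
    then show ?thesis using poly_space.subspace_0[OF U] by simp
  next
    case False
    obtain u where u: "u \<in> U" "u \<noteq> 0" "degree u = degree f"
      using deg by blast
    define a where "a = lead_coeff f / lead_coeff u"
    have au: "smult a u \<in> U" using poly_space.subspace_scale[OF U u(1)] .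
    have top: "coeff (f - smult a u) (degree f) = 0"
      using u False by (simp add: a_def flip: u(3))
    have le: "degree (f - smult a u) \<le> degree f"
      using u by (intro degree_diff_le) auto
    have "f - smult a u \<in> U"
    proof (cases "degree (f - smult a u) < degree f")
      case True
      then show ?thesis by (rule less)
    next
      case False
      then have "f - smult a u = 0" using le top leading_coeff_0_iff
        by (metis le_neq_implies_less)
      then show ?thesis using poly_space.subspace_0[OF U] by simp
    qed
    then have "(f - smult a u) + smult a u \<in> U"
      using au poly_space.subspace_add[OF U] by blast
    then show ?thesis by simp
  qed
qed

text \<open>
  The coefficient \<open>a\<close> is arbitrary, so that it can be chosen to cancel a common component of \<open>v\<close>
  and \<open>w\<close>.
\<close>

lemma order_combination_eq_min:
  fixes v w :: "'a :: field poly"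
  assumes "v \<noteq> 0" "w \<noteq> 0" "order z v < order z w" "b \<noteq> 0"
  shows "smult b v - smult a w \<noteq> 0" "order z (smult b v - smult a w) = order z v"
proof -
  let ?l = "[:- z, 1:]"
  have w: "?l ^ Suc (order z v) dvd smult a w"
    using assms(3) by (intro dvd_smult) (simp add: order_divides del: power_Suc)
  have v: "\<not> ?l ^ Suc (order z v) dvd smult b v"
    using order_2[OF assms(1)] assms(4) by (simp add: dvd_smult_iff del: power_Suc)
  have nd: "\<not> ?l ^ Suc (order z v) dvd smult b v - smult a w"
    using v w by (metis dvd_add diff_add_cancel)
  then show "smult b v - smult a w \<noteq> 0" by (metis dvd_0_right)
  have "?l ^ order z v dvd smult b v - smult a w"
    using assms(3) by (intro dvd_diff dvd_smult) (simp_all add: order_divides)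
  then show "order z (smult b v - smult a w) = order z v"
    using nd by (rule order_unique_lemma)
qed

text \<open>
  Adjoining one polynomial \<open>g\<close> to \<open>U\<close> creates at most one new order: if \<open>v - a * g\<close> and \<open>w - b * g\<close>
  lie in \<open>U\<close> and \<open>v\<close>, \<open>w\<close> have distinct new orders, then \<open>b * v - a * w\<close> lies in \<open>U\<close> and still
  has the smaller of these. Adjoining the monomials of the missing degrees one at a time leads
  from \<open>U\<close> to the space of all polynomials, where every order occurs.
\<close>

lemma finite_missing_orders:
  fixes U :: "'a :: field poly set"
  assumes "finite K" "poly_space.subspace U"
    and "\<And>k. k \<notin> K \<Longrightarrow> \<exists>u\<in>U. u \<noteq> 0 \<and> degree u = k"
  shows "finite (- order z ` (U - {0}))"
  using assms
proof (induction K arbitrary: U rule: finite_induct)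
  case empty
  have "n \<in> order z ` (U - {0})" for n
  proof -
    have "[:- z, 1:] ^ n \<in> U"
      by (rule subspace_all_degrees_eq_UNIV) (use empty in auto)
    moreover have "[:- z, 1:] ^ n \<noteq> 0" by simp
    ultimately show ?thesis using order_power_n_n[of z n] by (metis DiffI imageI singletonD)
  qed
  then have "order z ` (U - {0}) = UNIV" by blast
  then show ?case by simp
next
  case (insert k K)
  let ?g = "monom 1 k :: 'a poly"
  let ?U = "poly_space.span (insert ?g U)"
  have sub: "U \<subseteq> ?U"
    using poly_space.span_superset[of "insert ?g U"] by auto
  have "\<exists>u\<in>?U. u \<noteq> 0 \<and> degree u = j" if "j \<notin> K" for j
  proof (cases "j = k")
    case True
    have "?g \<in> ?U" by (rule poly_space.span_base) simp
    then show ?thesis using True by (intro bexI[of _ ?g]) (simp_all add: degree_monom_eq)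
  next
    case False
    then show ?thesis using insert.prems(2)[of j] that sub by auto
  qed
  then have fin: "finite (- order z ` (?U - {0}))"
    by (intro insert.IH) auto
  define N where "N = order z ` (?U - {0}) - order z ` (U - {0})"
  have decomp: "\<exists>a. u - smult a ?g \<in> U" if "u \<in> ?U" for u
    using that insert.prems(1) poly_space.span_insert[of ?g U]
    by (simp add: poly_space.span_eq_iff[THEN iffD2])
  have "\<not> m < n" if "m \<in> N" "n \<in> N" for m n
  proof
    assume lt: "m < n"
    obtain v w where vw: "v \<in> ?U" "v \<noteq> 0" "order z v = m" "w \<in> ?U" "w \<noteq> 0" "order z w = n"
      using \<open>m \<in> N\<close> \<open>n \<in> N\<close> unfolding N_def by auto
    obtain a b where a: "v - smult a ?g \<in> U" and b: "w - smult b ?g \<in> U"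
      using decomp vw by blast
    \<comment> \<open>As \<open>n\<close> is a new order, \<open>w\<close> is not in \<open>U\<close>.\<close>
    have "b \<noteq> 0"
    proof
      assume "b = 0"
      then have "w \<in> U" using b by simp
      then show False using vw \<open>n \<in> N\<close> unfolding N_def by auto
    qed
    have "smult b (v - smult a ?g) - smult a (w - smult b ?g) \<in> U"
      by (intro poly_space.subspace_diff[OF insert.prems(1)]
          poly_space.subspace_scale[OF insert.prems(1)] a b)
    moreover have "smult b (v - smult a ?g) - smult a (w - smult b ?g) = smult b v - smult a w"
      by (simp add: smult_diff_right mult.commute)
    ultimately have "smult b v - smult a w \<in> U" by simp
    then have "m \<in> order z ` (U - {0})"
      using order_combination_eq_min[of v w z b a] vw lt \<open>b \<noteq> 0\<close>
      by (metis DiffI imageI singletonD)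
    then show False using \<open>m \<in> N\<close> unfolding N_def by simp
  qed
  then have "m = n" if "m \<in> N" "n \<in> N" for m n
    using that by (meson linorder_neqE_nat)
  then have "finite N"
    by (metis finite.simps finite_subset subsetI singletonI insert_iff)
  moreover have "- order z ` (U - {0}) \<subseteq> - order z ` (?U - {0}) \<union> N"
    unfolding N_def by blast
  ultimately show ?case using fin finite_subset by blast
qed

section \<open>Laurent expansions of polynomials and rational functions\<close>

lemma poly_laurent_0 [simp]: "poly_laurent z 0 = 0"
  and poly_laurent_1 [simp]: "poly_laurent z 1 = 1"
  and poly_laurent_add: "poly_laurent z (f + g) = poly_laurent z f + poly_laurent z g"
  and poly_laurent_mult: "poly_laurent z (f * g) = poly_laurent z f * poly_laurent z g"
  and poly_laurent_smult: "poly_laurent z (smult c f) = fls_const c * poly_laurent z f"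
  and poly_laurent_pderiv: "poly_laurent z (pderiv f) = fls_deriv (poly_laurent z f)"
  by (simp_all add: poly_laurent_def pcompose_add pcompose_mult pcompose_smult pcompose_1
      fps_of_poly_add fps_of_poly_mult fps_of_poly_smult fls_times_fps_to_fls
      fls_deriv_fps_to_fls pderiv_pcompose pderiv_pCons
      flip: fps_of_poly_pderiv)

lemma poly_laurent_eq_0_iff [simp]: "poly_laurent z f = 0 \<longleftrightarrow> f = 0"
proof -
  have "pcompose f [:z, 1:] = 0 \<longleftrightarrow> f = 0"
    by (rule pcompose_eq_0_iff) simp
  then show ?thesis
    by (simp add: poly_laurent_def fps_of_poly_eq_iff[of _ 0, simplified])
qed

lemma poly_laurent_power: "poly_laurent z (f ^ n) = poly_laurent z f ^ n"
  by (induction n) (simp_all add: poly_laurent_mult)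

lemma poly_laurent_nth_0: "poly_laurent z f $$ 0 = poly f z"
  by (simp add: poly_laurent_def flip: poly_0_coeff_0) (simp add: poly_pcompose)

lemma subdegree_poly_laurent:
  assumes "f \<noteq> 0"
  shows "fls_subdegree (poly_laurent z f) = int (order z f)"
proof -
  obtain h where h: "f = [:- z, 1:] ^ order z f * h" "\<not> [:- z, 1:] dvd h"
    using order_decomp[OF assms] by blast
  have "poly_laurent z [:- z, 1:] = fls_X"
    by (simp add: poly_laurent_def pcompose_pCons fls_X_def)
  then have "poly_laurent z f = fls_X ^ order z f * poly_laurent z h"
    using h(1) by (metis poly_laurent_mult poly_laurent_power)
  moreover have "fls_subdegree (poly_laurent z h) = 0"
  proof (rule fls_subdegree_eqI)
    show "poly_laurent z h $$ 0 \<noteq> 0"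
      using h(2) by (simp add: poly_laurent_nth_0 poly_eq_0_iff_dvd)
  qed (simp add: poly_laurent_def)
  moreover have "h \<noteq> 0" using h(2) by auto
  ultimately show ?thesis by simp
qed

text \<open>
  The Laurent series of a rational function is defined through its reduced fraction. Any other
  fraction gives the same series, so that \<^const>\<open>ratfun_laurent\<close> is a ring homomorphism and
  carries the action of \<open>T\<close> on polynomials over to Laurent series.
\<close>

lemma ratfun_laurent_quotient:
  assumes "g \<noteq> 0"
  shows "ratfun_laurent z (to_fract f / to_fract g) = poly_laurent z f / poly_laurent z g"
proof -
  define a b where "a = fst (quot_of_fract (to_fract f / to_fract g))"
    and "b = snd (quot_of_fract (to_fract f / to_fract g))"
  have b: "b \<noteq> 0" by (simp add: b_def)
  have "to_fract f / to_fract g = to_fract a / to_fract b"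
    using quot_to_fract_quot_of_fract[of "to_fract f / to_fract g"]
    by (simp add: quot_to_fract_def Fract_conv_to_fract a_def b_def case_prod_unfold)
  then have "to_fract (f * b) = to_fract (a * g)"
    using assms b by (simp add: divide_simps)
  then have "f * b = a * g" by (simp only: to_fract_eq_iff)
  then have "poly_laurent z f * poly_laurent z b = poly_laurent z a * poly_laurent z g"
    by (metis poly_laurent_mult)
  then show ?thesis
    using assms b by (simp add: ratfun_laurent_def a_def[symmetric] b_def[symmetric] divide_simps)
qed

lemma ratfun_as_quotient:
  fixes f :: "complex poly fract"
  obtains a b where "b \<noteq> 0" "f = to_fract a / to_fract b"
  by (metis Fract_conv_to_fract Fract_cases)

lemma ratfun_laurent_to_fract: "ratfun_laurent z (to_fract f) = poly_laurent z f"
  using ratfun_laurent_quotient[of 1 z f] by simp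

lemma ratfun_laurent_add: "ratfun_laurent z (f + g) = ratfun_laurent z f + ratfun_laurent z g"
  and ratfun_laurent_mult: "ratfun_laurent z (f * g) = ratfun_laurent z f * ratfun_laurent z g"
proof -
  obtain a b where f: "b \<noteq> 0" "f = to_fract a / to_fract b" by (rule ratfun_as_quotient)
  obtain c d where g: "d \<noteq> 0" "g = to_fract c / to_fract d" by (rule ratfun_as_quotient)
  have "f + g = to_fract (a * d + c * b) / to_fract (b * d)"
    and "f * g = to_fract (a * c) / to_fract (b * d)"
    unfolding f(2) g(2) using f(1) g(1) by (simp_all add: divide_simps)
  then have "ratfun_laurent z (f + g) = poly_laurent z (a * d + c * b) / poly_laurent z (b * d)"
    and "ratfun_laurent z (f * g) = poly_laurent z (a * c) / poly_laurent z (b * d)"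
    using ratfun_laurent_quotient[of "b * d" z] f(1) g(1) by (simp_all del: to_fract_mult to_fract_add)
  moreover have "ratfun_laurent z f = poly_laurent z a / poly_laurent z b"
    and "ratfun_laurent z g = poly_laurent z c / poly_laurent z d"
    using f g by (simp_all add: ratfun_laurent_quotient)
  ultimately show "ratfun_laurent z (f + g) = ratfun_laurent z f + ratfun_laurent z g"
    and "ratfun_laurent z (f * g) = ratfun_laurent z f * ratfun_laurent z g"
    using f(1) g(1) by (simp_all only: poly_laurent_add poly_laurent_mult)
      (simp_all add: divide_simps)
qed

lemma op_laurent_poly_laurent:
  assumes "op_poly p q r y = to_fract w"
  shows "op_laurent p q r z (poly_laurent z y) = poly_laurent z w"
proof -
  have "ratfun_laurent z (op_poly p q r y) = poly_laurent z w"
    using assms by (simp add: ratfun_laurent_to_fract)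
  then show ?thesis
    by (simp add: op_poly_def op_laurent_def ratfun_laurent_add ratfun_laurent_mult
        ratfun_laurent_to_fract poly_laurent_pderiv)
qed

lemma ratfun_laurent_regular:
  assumes "ratfun_eval p z \<noteq> 0"
  shows "ratfun_laurent z p $$ 0 \<noteq> 0" "k < 0 \<Longrightarrow> ratfun_laurent z p $$ k = 0"
proof -
  define a b where "a = fst (quot_of_fract p)" and "b = snd (quot_of_fract p)"
  have ab: "poly a z \<noteq> 0" "poly b z \<noteq> 0"
    using assms by (auto simp: ratfun_eval_def a_def b_def)
  then have nz: "a \<noteq> 0" "b \<noteq> 0" by auto
  have "fls_subdegree (ratfun_laurent z p) = 0"
    using nz ab
    by (simp add: ratfun_laurent_def fls_divide_subdegree subdegree_poly_laurent order_0I
        flip: a_def b_def)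
  moreover have "ratfun_laurent z p \<noteq> 0"
    using nz by (simp add: ratfun_laurent_def flip: a_def b_def)
  ultimately show "ratfun_laurent z p $$ 0 \<noteq> 0" "k < 0 \<Longrightarrow> ratfun_laurent z p $$ k = 0"
    using nth_fls_subdegree_nonzero by (metis, simp)
qed

text \<open>
  Every element of the span is mapped to a polynomial although the coefficients of the operator
  may have poles, because the operator only rescales each eigenpolynomial.
\<close>

lemma eigenspan_stable:
  fixes p q r :: "complex poly fract"
  defines "E \<equiv> {y. \<exists>c. op_poly p q r y = to_fract (smult c y)}"
  assumes "u \<in> poly_space.span E"
  shows "\<exists>w\<in>poly_space.span E. op_poly p q r u = to_fract w"
  using assms(2)
proof (induction rule: poly_space.span_induct_alt)
  case base
  show ?case
    by (rule bexI[of _ 0]) (simp_all add: op_poly_def poly_space.span_zero)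
next
  case (step a y u)
  obtain c where c: "op_poly p q r y = to_fract (smult c y)" using step(1) by (auto simp: E_def)
  obtain w where w: "w \<in> poly_space.span E" "op_poly p q r u = to_fract w" using step by blast
  have sm: "to_fract (smult a x) = to_fract [:a:] * to_fract x" for x :: "complex poly"
    by (simp flip: to_fract_mult)
  have "op_poly p q r (smult a y + u) = to_fract [:a:] * op_poly p q r y + op_poly p q r u"
    by (simp add: op_poly_def pderiv_add pderiv_smult sm algebra_simps)
  also have "\<dots> = to_fract (smult a (smult c y) + w)"
    by (simp only: c w(2) sm[symmetric] to_fract_add)
  finally show ?case
    using step(1) w(1)
    by (intro bexI[of _ "smult a (smult c y) + w"] poly_space.span_add poly_space.span_scale)
      (auto intro: poly_space.span_base)
qed

section \<open>Frobenius' method beyond the exponents\<close>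

text \<open>
  Solves \<open>f n * w n + (\<Sum>k<n. t n k * w k) = h n\<close> for \<open>n > N\<close>, starting from \<open>w n = 0\<close> for
  \<open>n \<le> N\<close>.
\<close>

fun frobenius_coeff ::
  "(nat \<Rightarrow> 'a) \<Rightarrow> (nat \<Rightarrow> nat \<Rightarrow> 'a) \<Rightarrow> (nat \<Rightarrow> 'a :: field) \<Rightarrow> nat \<Rightarrow> nat \<Rightarrow> 'a" where
  "frobenius_coeff f t h N n =
     (if n \<le> N then 0 else (h n - (\<Sum>k<n. t n k * frobenius_coeff f t h N k)) / f n)"

declare frobenius_coeff.simps [simp del]

lemma fps_coeff_geometric_bound:
  fixes F :: "complex fps"
  assumes "fps_conv_radius F > 0"
  obtains M D :: real where "M > 0" "D > 0" "\<And>n. norm (F $ n) \<le> M * D ^ n"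
proof -
  obtain e where e: "0 < e" "ereal e < fps_conv_radius F"
    using ereal_dense2[OF assms] by (auto simp: zero_ereal_def)
  have "summable (\<lambda>n. F $ n * complex_of_real e ^ n)"
    using e unfolding fps_conv_radius_def by (intro summable_in_conv_radius) simp
  then have "Bseq (\<lambda>n. F $ n * complex_of_real e ^ n)"
    by (intro convergent_imp_Bseq) (auto dest: summable_LIMSEQ_zero simp: convergent_def)
  then obtain M where M: "M > 0" "\<And>n. norm (F $ n * complex_of_real e ^ n) \<le> M"
    by (auto elim: BseqE)
  show ?thesis
  proof
    show "M > 0" "1 / e > 0" using M e by auto
    show "norm (F $ n) \<le> M * (1 / e) ^ n" for n
      using M(2)[of n] e by (simp add: norm_mult norm_power divide_simps)
  qed
qed

lemma fps_conv_radius_pos_of_geometric_bound: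
  fixes F :: "complex fps"
  assumes "\<And>n. norm (F $ n) \<le> M * D ^ n" "D > 0"
  shows "fps_conv_radius F > 0"
proof -
  define e where "e = 1 / (2 * D)"
  have e: "e > 0" using assms by (simp add: e_def)
  have "summable (\<lambda>n. F $ n * complex_of_real e ^ n)"
  proof (rule summable_comparison_test)
    show "\<exists>N. \<forall>n\<ge>N. norm (F $ n * complex_of_real e ^ n) \<le> M * (1 / 2) ^ n"
    proof (intro exI allI impI)
      fix n
      have "norm (F $ n * complex_of_real e ^ n) = norm (F $ n) * e ^ n"
        using e by (simp add: norm_mult norm_power)
      also have "\<dots> \<le> M * D ^ n * e ^ n"
        using assms(1)[of n] e by (intro mult_right_mono) auto
      also have "\<dots> = M * (D * e) ^ n" by (simp add: power_mult_distrib)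
      also have "D * e = 1 / 2" using assms(2) by (simp add: e_def)
      finally show "norm (F $ n * complex_of_real e ^ n) \<le> M * (1 / 2) ^ n" .
    qed
    show "summable (\<lambda>n. M * (1 / 2) ^ n :: real)"
      by (intro summable_mult summable_geometric) auto
  qed
  then have "ereal (norm (complex_of_real e)) \<le> conv_radius (fps_nth F)"
    by (rule conv_radius_geI)
  moreover have "ereal (norm (complex_of_real e)) > 0" using e by simp
  ultimately show ?thesis unfolding fps_conv_radius_def
    by (meson order_less_le_trans)
qed

text \<open>
  The bound \<open>v n = G * (1 + G) ^ n\<close> is the solution of the recursion with equality.
\<close>

lemma discrete_gronwall:
  fixes v :: "nat \<Rightarrow> real"
  assumes "G \<ge> 0" "\<And>n. v n \<le> G * (1 + (\<Sum>k<n. v k))"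
  shows "v n \<le> G * (1 + G) ^ n"
proof (induction n rule: less_induct)
  case (less n)
  have geo: "1 + (\<Sum>k<n. G * (1 + G) ^ k) = (1 + G) ^ n"
    by (induction n) (simp_all add: algebra_simps)
  have "v n \<le> G * (1 + (\<Sum>k<n. v k))" by (rule assms)
  also have "\<dots> \<le> G * (1 + (\<Sum>k<n. G * (1 + G) ^ k))"
    using less assms(1) by (intro mult_left_mono add_left_mono sum_mono) auto
  finally show ?case by (simp only: geo)
qed

text \<open>
  The quotient of the quadratic polynomial by \<open>(n + 1)\<^sup>2\<close> tends to \<open>a \<noteq> 0\<close> and vanishes for no
  integer \<open>n > N\<close>, so it is bounded away from 0 there. This makes up for the quadratic growth in \<open>k\<close>
  of the recursion coefficients in Frobenius' method.
\<close>

lemma quadratic_reciprocal_bound: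
  fixes a b c :: complex
  assumes "a \<noteq> 0" "\<And>n. n > N \<Longrightarrow> of_nat n * (of_nat n - 1) * a + of_nat n * b + c \<noteq> 0"
  obtains C where "C > 0"
    "\<And>n. n > N \<Longrightarrow> (real n + 1)\<^sup>2 \<le> C * norm (of_nat n * (of_nat n - 1) * a + of_nat n * b + c)"
proof -
  define f where "f = (\<lambda>n. of_nat n * (of_nat n - 1) * a + of_nat n * b + c)"
  have t: "(\<lambda>n. 1 / of_nat (Suc n) :: complex) \<longlonglongrightarrow> 0"
    using LIMSEQ_Suc[OF lim_1_over_n[where 'a = complex]] .
  have "(\<lambda>n. (1 - 1 / of_nat (Suc n)) * (1 - 2 / of_nat (Suc n)) * a
        + (1 / of_nat (Suc n)) * (1 - 1 / of_nat (Suc n)) * b + (1 / of_nat (Suc n))\<^sup>2 * c)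
      \<longlonglongrightarrow> (1 - 0) * (1 - 2 * 0) * a + 0 * (1 - 0) * b + 0\<^sup>2 * c"
    using tendsto_mult_left[OF t, of 2] by (intro tendsto_intros t) simp_all
  moreover have "(\<lambda>n. (1 - 1 / of_nat (Suc n)) * (1 - 2 / of_nat (Suc n)) * a
        + (1 / of_nat (Suc n)) * (1 - 1 / of_nat (Suc n)) * b + (1 / of_nat (Suc n))\<^sup>2 * c)
      = (\<lambda>n. f n / (of_nat (Suc n))\<^sup>2)"
  proof
    fix n
    define m where "m = (of_nat (Suc n) :: complex)"
    have m: "m \<noteq> 0" and n: "of_nat n = m - 1" unfolding m_def by (simp_all del: of_nat_Suc) simp
    show "(1 - 1 / of_nat (Suc n)) * (1 - 2 / of_nat (Suc n)) * a
        + (1 / of_nat (Suc n)) * (1 - 1 / of_nat (Suc n)) * b + (1 / of_nat (Suc n))\<^sup>2 * c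
      = f n / (of_nat (Suc n))\<^sup>2"
      unfolding f_def m_def[symmetric] n using m by (simp add: field_simps power2_eq_square)
  qed
  ultimately have "(\<lambda>n. f n / (of_nat (Suc n))\<^sup>2) \<longlonglongrightarrow> (1 - 0) * (1 - 2 * 0) * a + 0 * (1 - 0) * b + 0\<^sup>2 * c"
    by (simp only:)
  then have "(\<lambda>n. f n / (of_nat (Suc n))\<^sup>2) \<longlonglongrightarrow> a" by (simp del: of_nat_Suc)
  then have "(\<lambda>n. inverse (f n / (of_nat (Suc n))\<^sup>2)) \<longlonglongrightarrow> inverse a"
    using assms(1) by (rule tendsto_inverse)
  then have "Bseq (\<lambda>n. inverse (f n / (of_nat (Suc n))\<^sup>2))"
    by (intro convergent_imp_Bseq) (auto simp: convergent_def)
  then obtain C where C: "C > 0" "\<And>n. norm (inverse (f n / (of_nat (Suc n))\<^sup>2)) \<le> C"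
    by (auto elim: BseqE)
  show ?thesis
  proof
    show "C > 0" by fact
    fix n assume "n > N"
    then have fn: "f n \<noteq> 0" using assms(2) by (simp add: f_def)
    have "norm (of_nat (Suc n) :: complex) = real n + 1" by (subst norm_of_nat) simp
    then have "norm (inverse (f n / (of_nat (Suc n))\<^sup>2)) = (real n + 1)\<^sup>2 / norm (f n)"
      by (simp add: norm_divide norm_power del: of_nat_Suc)
    then have "(real n + 1)\<^sup>2 / norm (f n) \<le> C" using C(2)[of n] by (simp only:)
    then show "(real n + 1)\<^sup>2 \<le> C * norm (of_nat n * (of_nat n - 1) * a + of_nat n * b + c)"
      using fn by (simp add: f_def pos_divide_le_eq)
  qed
qed

text \<open>
  Frobenius' method for an inhomogeneous equation at a regular singular point. Beyond all
  exponents the coefficients of \<open>W\<close> are determined recursively, and only the convergence of \<open>W\<close>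
  needs an argument: if the coefficients of \<open>A\<close>, \<open>B\<close>, \<open>C\<close>, \<open>H\<close> are bounded by \<open>M * D ^ n\<close>, then
  the normalised coefficients \<open>norm (W $ n) / D ^ n\<close> satisfy a recursive inequality of Gronwall
  type.
\<close>

lemma frobenius_solution_fps:
  fixes A B C H :: "complex fps"
  assumes rad: "fps_conv_radius A > 0" "fps_conv_radius B > 0"
      "fps_conv_radius C > 0" "fps_conv_radius H > 0"
    and A0: "A $ 0 \<noteq> 0"
    and nonres: "\<And>n. n > N \<Longrightarrow>
      of_nat n * (of_nat n - 1) * A $ 0 + of_nat n * B $ 0 + C $ 0 \<noteq> 0"
    and H: "\<And>n. n \<le> N \<Longrightarrow> H $ n = 0"
  obtains W where "fps_conv_radius W > 0" "\<And>n. n \<le> N \<Longrightarrow> W $ n = 0"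
    "A * (fps_X\<^sup>2 * fps_deriv (fps_deriv W)) + B * (fps_X * fps_deriv W) + C * W = H"
proof -
  define t where "t = (\<lambda>n k. of_nat k * (of_nat k - 1) * A $ (n - k)
      + of_nat k * B $ (n - k) + C $ (n - k))"
  define f where "f = (\<lambda>n. t n n)"
  define w where "w = frobenius_coeff f t (fps_nth H) N"
  define W where "W = Abs_fps w"
  have w: "w n = (if n \<le> N then 0 else (H $ n - (\<Sum>k<n. t n k * w k)) / f n)" for n
    unfolding w_def by (subst frobenius_coeff.simps) simp
  have f: "f n = of_nat n * (of_nat n - 1) * A $ 0 + of_nat n * B $ 0 + C $ 0" for n
    by (simp add: f_def t_def)
  have fnz: "f n \<noteq> 0" if "n > N" for n using nonres[OF that] by (simp add: f)
  have low: "W $ n = 0" if "n \<le> N" for n using that by (simp add: W_def w)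

  have "A * (fps_X\<^sup>2 * fps_deriv (fps_deriv W)) + B * (fps_X * fps_deriv W) + C * W = H"
  proof (rule fps_ext)
    fix n
    define E1 E2 where "E1 = fps_X * fps_deriv W" and "E2 = fps_X\<^sup>2 * fps_deriv (fps_deriv W)"
    have E1: "E1 $ k = of_nat k * w k" for k
      unfolding E1_def by (cases k) (simp_all add: W_def)
    have E2: "E2 $ k = of_nat k * (of_nat k - 1) * w k" for k
    proof -
      consider "k = 0" | "k = 1" | j where "k = Suc (Suc j)" by (metis One_nat_def not0_implies_Suc)
      then show ?thesis
        unfolding E2_def by cases (simp_all add: W_def fps_X_power_mult_nth)
    qed
    have "(A * E2 + B * E1 + C * W) $ n = (E2 * A + E1 * B + W * C) $ n"
      by (simp add: mult.commute)
    also have "\<dots> = (\<Sum>k=0..n. E2 $ k * A $ (n - k) + E1 $ k * B $ (n - k) + W $ k * C $ (n - k))"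
      by (simp add: fps_mult_nth sum.distrib)
    also have "\<dots> = (\<Sum>k=0..n. t n k * w k)"
      by (intro sum.cong refl) (simp add: E1 E2 W_def t_def algebra_simps)
    also have "{0..n} = insert n {..<n}" by auto
    also have "(\<Sum>k\<in>insert n {..<n}. t n k * w k) = f n * w n + (\<Sum>k<n. t n k * w k)"
      by (simp add: f_def)
    also have "\<dots> = H $ n"
    proof (cases "n \<le> N")
      case True
      then have "w k = 0" if "k \<le> n" for k using that by (simp add: w)
      then show ?thesis using H[OF True] by simp
    next
      case False
      then show ?thesis using fnz[of n] by (subst w) simp
    qed
    finally show "(A * (fps_X\<^sup>2 * fps_deriv (fps_deriv W)) + B * (fps_X * fps_deriv W) + C * W) $ n
      = H $ n" unfolding E1_def E2_def .
  qed
  moreover have "fps_conv_radius W > 0"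
  proof -
    obtain MA DA where a: "MA > 0" "DA > 0" "\<And>n. norm (A $ n) \<le> MA * DA ^ n"
      using fps_coeff_geometric_bound[OF rad(1)] by blast
    obtain MB DB where b: "MB > 0" "DB > 0" "\<And>n. norm (B $ n) \<le> MB * DB ^ n"
      using fps_coeff_geometric_bound[OF rad(2)] by blast
    obtain MC DC where c: "MC > 0" "DC > 0" "\<And>n. norm (C $ n) \<le> MC * DC ^ n"
      using fps_coeff_geometric_bound[OF rad(3)] by blast
    obtain MH DH where h: "MH > 0" "DH > 0" "\<And>n. norm (H $ n) \<le> MH * DH ^ n"
      using fps_coeff_geometric_bound[OF rad(4)] by blast
    define M where "M = MA + MB + MC + MH"
    define D where "D = DA + DB + DC + DH"
    have M: "M > 0" and D: "D > 0" using a b c h by (simp_all add: M_def D_def)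
    have bound: "x \<le> M * D ^ n" if "x \<le> m * d ^ n" "0 < m" "0 < d" "m \<le> M" "d \<le> D"
      for x m d :: real and n
    proof -
      have "m * d ^ n \<le> M * D ^ n"
        using that by (intro mult_mono power_mono) auto
      then show ?thesis using that(1) by linarith
    qed
    have A: "norm (A $ n) \<le> M * D ^ n" for n
      by (rule bound[OF a(3)]) (use a b c h in \<open>simp_all add: M_def D_def\<close>)
    have B: "norm (B $ n) \<le> M * D ^ n" for n
      by (rule bound[OF b(3)]) (use a b c h in \<open>simp_all add: M_def D_def\<close>)
    have C: "norm (C $ n) \<le> M * D ^ n" for n
      by (rule bound[OF c(3)]) (use a b c h in \<open>simp_all add: M_def D_def\<close>)
    have Hb: "norm (H $ n) \<le> M * D ^ n" for n
      by (rule bound[OF h(3)]) (use a b c h in \<open>simp_all add: M_def D_def\<close>)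
    obtain c0 where c0: "c0 > 0" "\<And>n. n > N \<Longrightarrow> (real n + 1)\<^sup>2 \<le> c0 * norm (f n)"
      using quadratic_reciprocal_bound[OF A0 nonres] unfolding f by blast
    have t_bound: "norm (t n k) \<le> (real n + 1)\<^sup>2 * (M * D ^ (n - k))" if "k < n" for n k
    proof -
      have k1: "norm (of_nat k * (of_nat k - 1) :: complex) \<le> real k * real k"
      proof (cases k)
        case (Suc j)
        then have "of_nat k * (of_nat k - 1) = (of_nat (k * j) :: complex)" by (simp add: algebra_simps)
        then have "norm (of_nat k * (of_nat k - 1) :: complex) = real (k * j)"
          by (simp only: norm_of_nat)
        then show ?thesis using Suc by (simp add: algebra_simps)
      qed simp
      have "norm (t n k) \<le> norm (of_nat k * (of_nat k - 1) * A $ (n - k))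
          + norm (of_nat k * B $ (n - k)) + norm (C $ (n - k))"
        unfolding t_def by (meson norm_triangle_ineq norm_triangle_le add_mono order_refl order_trans)
      also have "\<dots> \<le> (real k * real k) * (M * D ^ (n - k)) + real k * (M * D ^ (n - k))
          + 1 * (M * D ^ (n - k))"
        using A[of "n - k"] B[of "n - k"] C[of "n - k"] k1 M D
        by (intro add_mono) (auto simp: norm_mult intro!: mult_mono)
      also have "\<dots> = (real k * real k + real k + 1) * (M * D ^ (n - k))"
        by (simp add: algebra_simps)
      also have "\<dots> \<le> (real n + 1)\<^sup>2 * (M * D ^ (n - k))"
      proof (rule mult_right_mono)
        have "real k * real k \<le> real n * real n" "real k \<le> real n"
          using that by (auto intro!: mult_mono)
        then show "real k * real k + real k + 1 \<le> (real n + 1)\<^sup>2"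
          by (simp add: power2_eq_square algebra_simps)
      qed (use M D in simp)
      finally show ?thesis .
    qed
    define G where "G = c0 * M"
    have G: "G > 0" using c0 M by (simp add: G_def)
    define v where "v = (\<lambda>n. norm (w n) / D ^ n)"
    have v_nonneg: "v n \<ge> 0" for n using D by (simp add: v_def)
    have rec: "v n \<le> G * (1 + (\<Sum>k<n. v k))" for n
    proof (cases "n \<le> N")
      case True
      then have "v n = 0" by (simp add: v_def w)
      also have "0 \<le> G * (1 + (\<Sum>k<n. v k))"
        using G v_nonneg by (intro mult_nonneg_nonneg add_nonneg_nonneg sum_nonneg) auto
      finally show ?thesis .
    next
      case False
      define S where "S = M * D ^ n * (1 + (\<Sum>k<n. v k))"
      have S: "S \<ge> 0" unfolding S_def
        using M D v_nonneg by (intro mult_nonneg_nonneg add_nonneg_nonneg sum_nonneg) auto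
      have "norm (H $ n - (\<Sum>k<n. t n k * w k)) \<le> norm (H $ n) + (\<Sum>k<n. norm (t n k * w k))"
        by (rule order_trans[OF norm_triangle_ineq4 add_left_mono[OF norm_sum]])
      also have "\<dots> \<le> (real n + 1)\<^sup>2 * (M * D ^ n) + (\<Sum>k<n. (real n + 1)\<^sup>2 * (M * D ^ n * v k))"
      proof (intro add_mono sum_mono)
        have "1 * (M * D ^ n) \<le> (real n + 1)\<^sup>2 * (M * D ^ n)"
          using M D by (intro mult_right_mono) (auto simp: power2_eq_square algebra_simps)
        then show "norm (H $ n) \<le> (real n + 1)\<^sup>2 * (M * D ^ n)" using Hb[of n] by linarith
      next
        fix k assume k: "k \<in> {..<n}"
        have "norm (t n k * w k) = norm (t n k) * (D ^ k * v k)"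
          using D by (simp add: norm_mult v_def)
        also have "\<dots> \<le> ((real n + 1)\<^sup>2 * (M * D ^ (n - k))) * (D ^ k * v k)"
          using t_bound[of k n] k D v_nonneg[of k] by (intro mult_right_mono) auto
        also have "\<dots> = (real n + 1)\<^sup>2 * (M * (D ^ (n - k) * D ^ k) * v k)" by simp
        also have "D ^ (n - k) * D ^ k = D ^ n" using k by (simp flip: power_add)
        finally show "norm (t n k * w k) \<le> (real n + 1)\<^sup>2 * (M * D ^ n * v k)" .
      qed
      also have "\<dots> = (real n + 1)\<^sup>2 * S"
        by (simp add: S_def sum_distrib_left algebra_simps)
      also have "\<dots> \<le> (c0 * norm (f n)) * S"
        using c0(2)[of n] False S by (intro mult_right_mono) auto
      finally have "norm (w n) \<le> c0 * S"
        using False fnz[of n] by (subst w) (simp add: norm_divide divide_simps mult_ac)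
      then show ?thesis
        using D by (simp add: v_def S_def G_def divide_simps mult_ac)
    qed
    have "v n \<le> G * (1 + G) ^ n" for n
      by (rule discrete_gronwall) (use G rec in auto)
    then have "norm (w n) \<le> G * (1 + G) ^ n * D ^ n" for n
      using D by (simp add: v_def divide_simps)
    then have "norm (W $ n) \<le> G * ((1 + G) * D) ^ n" for n
      by (simp add: W_def power_mult_distrib mult.assoc)
    then show ?thesis
      by (rule fps_conv_radius_pos_of_geometric_bound) (use G D in simp)
  qed
  ultimately show ?thesis using that low by blast
qed

section \<open>Leading terms of second order operators on Laurent series\<close>

definition diffop :: "complex fls \<Rightarrow> complex fls \<Rightarrow> complex fls \<Rightarrow> complex fls \<Rightarrow> complex fls" where
  "diffop P Q R F = P * fls_deriv (fls_deriv F) + Q * fls_deriv F + R * F"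

lemma diffop_linear:
  "diffop P Q R (F + fls_const a * G) = diffop P Q R F + fls_const a * diffop P Q R G"
  by (simp add: diffop_def algebra_simps)

lemma fls_mult_leading:
  fixes f g :: "'a :: {comm_monoid_add, mult_zero} fls"
  assumes f: "\<And>k. k < a \<Longrightarrow> f $$ k = 0" and g: "\<And>k. k < b \<Longrightarrow> g $$ k = 0"
  shows "j < a + b \<Longrightarrow> (f * g) $$ j = 0" "(f * g) $$ (a + b) = f $$ a * g $$ b"
proof -
  have "(j < a + b \<longrightarrow> (f * g) $$ j = 0) \<and> (f * g) $$ (a + b) = f $$ a * g $$ b"
  proof (cases "f = 0 \<or> g = 0")
    case False
    then have ab: "a \<le> fls_subdegree f" "b \<le> fls_subdegree g"
      using f g by (auto intro: fls_subdegree_geI)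
    have "(f * g) $$ (a + b) = f $$ a * g $$ b"
    proof (cases "a = fls_subdegree f \<and> b = fls_subdegree g")
      case True
      then show ?thesis by (simp add: fls_times_nth(2))
    next
      case False
      then have "f $$ a * g $$ b = 0" using ab by auto
      moreover have "a + b < fls_subdegree f + fls_subdegree g" using False ab by auto
      ultimately show ?thesis by (simp add: fls_times_nth_eq0)
    qed
    then show ?thesis using ab by (auto intro: fls_times_nth_eq0)
  qed auto
  then show "j < a + b \<Longrightarrow> (f * g) $$ j = 0" "(f * g) $$ (a + b) = f $$ a * g $$ b" by auto
qed

text \<open>
  The bounds on the poles of the coefficients under which the operator lowers the order of a
  series by at most \<open>s\<close>, because each derivative lowers it by at most 1.
  For \<open>s = 2\<close> and \<open>P $$ 0 \<noteq> 0\<close> this is the condition of Fuchs for a regular (or regular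
  singular) point.
\<close>

definition lowers_orders_by :: "int \<Rightarrow> complex fls \<Rightarrow> complex fls \<Rightarrow> complex fls \<Rightarrow> bool" where
  "lowers_orders_by s P Q R \<longleftrightarrow>
     (\<forall>k<2 - s. P $$ k = 0) \<and> (\<forall>k<1 - s. Q $$ k = 0) \<and> (\<forall>k<(- s). R $$ k = 0)"

text \<open>
  The polynomial \<open>n * (n - 1) * P $$ (2 - s) + n * Q $$ (1 - s) + R $$ (- s)\<close> in \<open>n\<close>, that is, the
  factor by which the operator multiplies a leading coefficient of order \<open>n\<close>. It is the classical
  indicial polynomial if \<open>s = 2\<close>.
\<close>

definition indicial_poly :: "int \<Rightarrow> complex fls \<Rightarrow> complex fls \<Rightarrow> complex fls \<Rightarrow> complex poly" where
  "indicial_poly s P Q R = [: R $$ (- s), Q $$ (1 - s) - P $$ (2 - s), P $$ (2 - s) :]"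

lemma diffop_leading:
  assumes "lowers_orders_by s P Q R" and F: "\<And>k. k < n \<Longrightarrow> F $$ k = 0"
  shows "j < n - s \<Longrightarrow> diffop P Q R F $$ j = 0"
    and "diffop P Q R F $$ (n - s) = poly (indicial_poly s P Q R) (of_int n) * F $$ n"
proof -
  have P: "\<And>k. k < 2 - s \<Longrightarrow> P $$ k = 0" and Q: "\<And>k. k < 1 - s \<Longrightarrow> Q $$ k = 0"
    and R: "\<And>k. k < - s \<Longrightarrow> R $$ k = 0"
    using assms(1) by (auto simp: lowers_orders_by_def)
  have F1: "\<And>k. k < n - 1 \<Longrightarrow> fls_deriv F $$ k = 0" using F by simp
  have F2: "\<And>k. k < n - 2 \<Longrightarrow> fls_deriv (fls_deriv F) $$ k = 0" using F by simp
  show "diffop P Q R F $$ j = 0" if "j < n - s"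
    using that fls_mult_leading(1)[of "2 - s" P "n - 2" _ j, OF P F2]
      fls_mult_leading(1)[of "1 - s" Q "n - 1" _ j, OF Q F1] fls_mult_leading(1)[of "- s" R n F j, OF R F]
    by (simp add: diffop_def)
  have "(P * fls_deriv (fls_deriv F)) $$ (n - s) = P $$ (2 - s) * (of_int (n - 1) * (of_int n * F $$ n))"
    using fls_mult_leading(2)[of "2 - s" P "n - 2", OF P F2] by (simp add: algebra_simps)
  moreover have "(Q * fls_deriv F) $$ (n - s) = Q $$ (1 - s) * (of_int n * F $$ n)"
    using fls_mult_leading(2)[of "1 - s" Q "n - 1", OF Q F1] by (simp add: algebra_simps)
  moreover have "(R * F) $$ (n - s) = R $$ (- s) * F $$ n"
    using fls_mult_leading(2)[of "- s" R n, OF R F] by (simp add: algebra_simps)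
  ultimately show "diffop P Q R F $$ (n - s) = poly (indicial_poly s P Q R) (of_int n) * F $$ n"
    by (simp add: diffop_def indicial_poly_def algebra_simps)
qed

lemma card_int_roots_le:
  fixes f :: "complex poly"
  assumes "f \<noteq> 0" "\<And>n. n \<in> A \<Longrightarrow> poly f (of_int n) = 0"
  shows "finite A" "card A \<le> degree f"
proof -
  have sub: "of_int ` A \<subseteq> {x. poly f x = 0}" using assms(2) by auto
  have fin: "finite {x. poly f x = 0}" using assms(1) by (rule poly_roots_finite)
  have inj: "inj_on (of_int :: int \<Rightarrow> complex) A" by (auto simp: inj_on_def)
  show "finite A" using finite_imageD[OF finite_subset[OF sub fin] inj] .
  have "card A = card ((of_int :: int \<Rightarrow> complex) ` A)" using card_image[OF inj] by simp
  also have "\<dots> \<le> card {x. poly f x = 0}" using card_mono[OF fin sub] .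
  also have "\<dots> \<le> degree f" using assms(1) by (rule card_poly_roots_bound)
  finally show "card A \<le> degree f" .
qed

lemma infinite_int_progression:
  assumes "s > 0"
  shows "infinite (range (\<lambda>k::nat. b + s * int k))"
  using assms by (intro range_inj_infinite) (auto simp: inj_def)

lemma least_in_residue_class:
  fixes I :: "int set"
  assumes I: "I \<subseteq> {0..}" "finite ({0..} - I)" and "0 \<le> b" "b < s"
  obtains n where "n \<in> I" "n mod s = b" "\<And>m. m \<in> I \<Longrightarrow> m mod s = b \<Longrightarrow> n \<le> m"
proof -
  have "\<not> range (\<lambda>k::nat. b + s * int k) \<subseteq> {0..} - I"
    using infinite_int_progression[of s b] assms finite_subset by auto
  then obtain k :: nat where k: "b + s * int k \<notin> {0..} - I" by blast
  have "b + s * int k \<ge> 0" using assms by simp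
  then have "b + s * int k \<in> I \<and> (b + s * int k) mod s = b" using k assms by simp
  then obtain n where n: "n \<in> I \<and> n mod s = b"
    "\<forall>m. m \<in> I \<and> m mod s = b \<longrightarrow> nat n \<le> nat m"
    using ex_has_least_nat[of "\<lambda>n. n \<in> I \<and> n mod s = b" "b + s * int k" nat] by blast
  show ?thesis
  proof
    show "n \<in> I" "n mod s = b" using n by auto
    show "n \<le> m" if "m \<in> I" "m mod s = b" for m
      using n that I(1) by (metis atLeast_iff nat_le_eq_zle order.trans subsetD nat_eq_iff2 nle_le)
  qed
qed

section \<open>Operators preserving a space with almost all orders\<close>

text \<open>
  The local picture at \<open>\<zeta>\<close> of an operator that preserves a space of polynomials of finite
  codimension: \<open>V\<close> consists of the expansions of these polynomials in the local variable.
\<close>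

locale stable_laurent_space =
  fixes P Q R :: "complex fls" and V :: "complex fls set"
  assumes lincomb: "F \<in> V \<Longrightarrow> G \<in> V \<Longrightarrow> F + fls_const a * G \<in> V"
    and stable: "F \<in> V \<Longrightarrow> diffop P Q R F \<in> V"
    and no_poles: "F \<in> V \<Longrightarrow> F \<noteq> 0 \<Longrightarrow> fls_subdegree F \<ge> 0"
    and cofinite_orders: "finite ({0..} - fls_subdegree ` (V - {0}))"
    and P_regular: "k < 0 \<Longrightarrow> P $$ k = 0"
    and P_nonzero: "P $$ 0 \<noteq> 0"
begin

definition orders :: "int set" where
  "orders = fls_subdegree ` (V - {0})"

lemma orders_nonneg: "orders \<subseteq> {0..}"
  using no_poles by (auto simp: orders_def)

lemma ordersE:
  assumes "n \<in> orders"
  obtains F where "F \<in> V" "F $$ n \<noteq> 0" "\<And>k. k < n \<Longrightarrow> F $$ k = 0"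
proof -
  obtain F where F: "F \<in> V" "F \<noteq> 0" "n = fls_subdegree F"
    using assms by (auto simp: orders_def)
  show ?thesis
    by (rule that[OF F(1)]) (use F in auto)
qed

lemma ordersI:
  assumes "F \<in> V" "F $$ n \<noteq> 0" "\<And>k. k < n \<Longrightarrow> F $$ k = 0"
  shows "n \<in> orders"
proof -
  have "fls_subdegree F = n" using assms(2,3) by (rule fls_subdegree_eqI)
  then show ?thesis using assms by (force simp: orders_def)
qed

lemma order_descends:
  assumes "lowers_orders_by s P Q R" "n \<in> orders" "poly (indicial_poly s P Q R) (of_int n) \<noteq> 0"
  shows "n - s \<in> orders"
proof -
  obtain F where F: "F \<in> V" "F $$ n \<noteq> 0" "\<And>k. k < n \<Longrightarrow> F $$ k = 0"
    using ordersE[OF assms(2)] by blast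
  show ?thesis
    by (rule ordersI[OF stable[OF F(1)]])
      (use diffop_leading[OF assms(1) F(3)] F(2) assms(3) in auto)
qed

text \<open>
  The least order in a residue class modulo \<open>s\<close> cannot be lowered by \<open>s\<close>, so by
  \<open>order_descends\<close> it is a root of the indicial polynomial.
\<close>

lemma residue_class_root:
  assumes "lowers_orders_by s P Q R" "0 \<le> b" "b < s"
  obtains n where "n \<in> orders" "n mod s = b" "poly (indicial_poly s P Q R) (of_int n) = 0"
    "\<And>m. m \<in> orders \<Longrightarrow> m mod s = b \<Longrightarrow> n \<le> m"
proof -
  obtain n where n: "n \<in> orders" "n mod s = b" "\<And>m. m \<in> orders \<Longrightarrow> m mod s = b \<Longrightarrow> n \<le> m"
    using least_in_residue_class[OF orders_nonneg _ assms(2,3)] cofinite_orders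
    unfolding orders_def by blast
  have "n - s \<notin> orders"
  proof
    assume "n - s \<in> orders"
    moreover have "(n - s) mod s = b" using n(2) by simp
    ultimately show False using n(3)[of "n - s"] assms by auto
  qed
  then show ?thesis using that n order_descends[OF assms(1) n(1)] by blast
qed

text \<open>
  For the least admissible \<open>s \<ge> 2\<close> the indicial polynomial is nonzero. It has a root in each of
  the \<open>s\<close> residue classes modulo \<open>s\<close>, but at most two roots.
\<close>

lemma fuchsian: "lowers_orders_by 2 P Q R"
proof -
  define s where "s = max 2 (max (1 - fls_subdegree Q) (- fls_subdegree R))"
  have low: "lowers_orders_by s P Q R"
    using P_regular by (auto simp: lowers_orders_by_def s_def)
  let ?f = "indicial_poly s P Q R"
  have nz: "?f \<noteq> 0"
  proof
    assume "?f = 0"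
    then have z: "R $$ (- s) = 0" "Q $$ (1 - s) = P $$ (2 - s)" "P $$ (2 - s) = 0"
      by (auto simp: indicial_poly_def)
    then have "s \<noteq> 2" using P_nonzero by auto
    then consider "s = 1 - fls_subdegree Q" "Q \<noteq> 0" | "s = - fls_subdegree R" "R \<noteq> 0"
      unfolding s_def by fastforce
    then show False
    proof cases
      case 1
      then have "Q $$ (1 - s) \<noteq> 0" by simp
      then show False using z by simp
    next
      case 2
      then have "R $$ (- s) \<noteq> 0" by simp
      then show False using z by simp
    qed
  qed
  have "\<exists>n. n mod s = b \<and> poly ?f (of_int n) = 0" if "b \<in> {0..<s}" for b
    using residue_class_root[OF low, of b] that by (metis atLeastLessThan_iff)
  then obtain r where r: "\<And>b. b \<in> {0..<s} \<Longrightarrow> r b mod s = b \<and> poly ?f (of_int (r b)) = 0"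
    by metis
  have "inj_on r {0..<s}" using r by (metis inj_onI)
  then have "card (r ` {0..<s}) = nat s" by (simp add: card_image)
  moreover have "card (r ` {0..<s}) \<le> degree ?f"
    by (rule card_int_roots_le[OF nz]) (use r in auto)
  moreover have "degree ?f \<le> 2" by (simp add: indicial_poly_def)
  ultimately have "s = 2" unfolding s_def by linarith
  then show ?thesis using low by simp
qed

text \<open>
  The two roots are the least even and the least odd order. In particular their difference is
  odd, and going down from either of them in steps of 2 leads out of the set of orders.
\<close>

lemma indicial_exponents:
  obtains M N where "M \<in> orders" "N \<in> orders" "M < N"
    "\<And>n. poly (indicial_poly 2 P Q R) (of_int n) = 0 \<longleftrightarrow> n = M \<or> n = N"
    "\<And>k. k > 0 \<Longrightarrow> M - 2 * k \<notin> orders" "\<And>k. k > 0 \<Longrightarrow> N - 2 * k \<notin> orders"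
proof -
  let ?f = "indicial_poly 2 P Q R"
  obtain m where m: "m \<in> orders" "m mod 2 = 0" "poly ?f (of_int m) = 0"
    "\<And>k. k \<in> orders \<Longrightarrow> k mod 2 = 0 \<Longrightarrow> m \<le> k"
    using residue_class_root[OF fuchsian, of 0] by auto
  obtain n where n: "n \<in> orders" "n mod 2 = 1" "poly ?f (of_int n) = 0"
    "\<And>k. k \<in> orders \<Longrightarrow> k mod 2 = 1 \<Longrightarrow> n \<le> k"
    using residue_class_root[OF fuchsian, of 1] by auto
  have "m \<noteq> n" using m n by auto
  have nz: "?f \<noteq> 0" using P_nonzero by (auto simp: indicial_poly_def)
  have only: "poly ?f (of_int k) = 0 \<longleftrightarrow> k = m \<or> k = n" for k
  proof (rule ccontr)
    assume k: "\<not> ?thesis"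
    then have "card {m, n, k} = 3" using m n \<open>m \<noteq> n\<close> by auto
    moreover have "card {m, n, k} \<le> degree ?f"
      by (rule card_int_roots_le[OF nz]) (use m n k in auto)
    moreover have "degree ?f \<le> 2" by (simp add: indicial_poly_def)
    ultimately show False by simp
  qed
  have below: "m - 2 * k \<notin> orders" "n - 2 * k \<notin> orders" if "k > 0" for k
  proof -
    have "(m - 2 * k) mod 2 = 0" "(n - 2 * k) mod 2 = 1" using m(2) n(2) by presburger+
    then show "m - 2 * k \<notin> orders" "n - 2 * k \<notin> orders"
      using m(4)[of "m - 2 * k"] n(4)[of "n - 2 * k"] that by auto
  qed
  show ?thesis
  proof (cases "m < n")
    case True
    then show ?thesis using that[of m n] m n only below by blast
  next
    case False
    then have "n < m" using \<open>m \<noteq> n\<close> by simp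
    then show ?thesis using that[of n m] m n only below by blast
  qed
qed

text \<open>
  If \<open>m + 2\<close> were missing, then so would be \<open>m + 4\<close>, \<open>m + 6\<close>, \<open>\<dots>\<close>: each of them is above \<open>m\<close> in
  its parity class and hence not a root, so that its presence would imply that of its
  predecessor. But only finitely many orders are missing.
\<close>

lemma order_ascends:
  assumes root: "\<And>n k. poly (indicial_poly 2 P Q R) (of_int n) = 0 \<Longrightarrow> k > 0 \<Longrightarrow> n - 2 * k \<notin> orders"
    and m: "m \<in> orders"
  shows "m + 2 \<in> orders"
proof (rule ccontr)
  assume no: "m + 2 \<notin> orders"
  have "(m + 2) + 2 * int j \<notin> orders" for j
  proof (induction j)
    case 0
    then show ?case using no by simp
  next
    case (Suc j)
    show ?case
    proof
      assume in_orders: "(m + 2) + 2 * int (Suc j) \<in> orders"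
      have "poly (indicial_poly 2 P Q R) (of_int ((m + 2) + 2 * int (Suc j))) \<noteq> 0"
      proof
        assume "poly (indicial_poly 2 P Q R) (of_int ((m + 2) + 2 * int (Suc j))) = 0"
        from root[OF this, of "int j + 2"] show False using m by (simp add: algebra_simps)
      qed
      from order_descends[OF fuchsian in_orders this] show False
        using Suc by (simp add: algebra_simps)
    qed
  qed
  then have "range (\<lambda>j::nat. (m + 2) + 2 * int j) \<subseteq> {0..} - orders"
    using m orders_nonneg by fastforce
  then show False
    using infinite_int_progression[of 2 "m + 2"] cofinite_orders finite_subset
    unfolding orders_def by auto
qed

text \<open>
  This is where the logarithmic obstruction disappears. The leading term of \<open>T v\<close> can be removed
  within \<open>V\<close> because its order \<open>m\<close> is again the order of an element of \<open>V\<close>. Then so is \<open>m + 2\<close>,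
  which is not a root since two below a root there is no order. An element of order \<open>m + 2\<close> is therefore
  mapped to one of order exactly \<open>m\<close>.
\<close>

lemma approximate_solution:
  assumes n: "n \<in> orders" "poly (indicial_poly 2 P Q R) (of_int n) = 0"
    and root: "\<And>n k. poly (indicial_poly 2 P Q R) (of_int n) = 0 \<Longrightarrow> k > 0 \<Longrightarrow> n - 2 * k \<notin> orders"
  shows "\<exists>v\<in>V. v $$ n \<noteq> 0 \<and> (\<forall>k<n. v $$ k = 0)
    \<and> (\<forall>k<n - 1 + int j. diffop P Q R v $$ k = 0)"
proof (induction j)
  case 0
  obtain v where v: "v \<in> V" "v $$ n \<noteq> 0" "\<And>k. k < n \<Longrightarrow> v $$ k = 0"
    using ordersE[OF n(1)] by blast
  \<comment> \<open>The coefficient at \<open>n - 2\<close> vanishes because \<open>n\<close> is an exponent.\<close>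
  have "diffop P Q R v $$ k = 0" if "k < n - 1" for k
    using that diffop_leading(1)[of 2 P Q R n v k, OF fuchsian v(3)]
      diffop_leading(2)[of 2 P Q R n v, OF fuchsian v(3)] n(2)
    by (cases "k = n - 2") auto
  then show ?case using v by auto
next
  case (Suc j)
  then obtain v where v: "v \<in> V" "v $$ n \<noteq> 0" "\<And>k. k < n \<Longrightarrow> v $$ k = 0"
    "\<And>k. k < n - 1 + int j \<Longrightarrow> diffop P Q R v $$ k = 0" by blast
  define m where "m = n - 1 + int j"
  show ?case
  proof (cases "diffop P Q R v $$ m = 0")
    case True
    have "diffop P Q R v $$ k = 0" if "k < n - 1 + int (Suc j)" for k
      using that True v(4)[of k] by (cases "k = m") (auto simp: m_def)
    then show ?thesis using v by blast
  next
    case False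
    have m: "m \<in> orders"
      by (rule ordersI[OF stable[OF v(1)] False]) (use v(4) in \<open>simp add: m_def\<close>)
    then have m2: "m + 2 \<in> orders" using order_ascends root by blast
    have nonroot: "poly (indicial_poly 2 P Q R) (of_int (m + 2)) \<noteq> 0"
    proof
      assume "poly (indicial_poly 2 P Q R) (of_int (m + 2)) = 0"
      from root[OF this, of 1] show False using m by simp
    qed
    obtain u where u: "u \<in> V" "u $$ (m + 2) \<noteq> 0" "\<And>k. k < m + 2 \<Longrightarrow> u $$ k = 0"
      using ordersE[OF m2] by blast
    define d where "d = diffop P Q R u $$ m"
    have d: "d \<noteq> 0"
      using diffop_leading(2)[of 2 P Q R "m + 2" u, OF fuchsian u(3)] nonroot u(2) by (simp add: d_def)
    define a where "a = - (diffop P Q R v $$ m) / d"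
    define v' where "v' = v + fls_const a * u"
    have "v' \<in> V" unfolding v'_def using v(1) u(1) by (rule lincomb)
    moreover have "v' $$ k = v $$ k" if "k \<le> n" for k
      using that u(3)[of k] by (simp add: v'_def m_def)
    moreover have "diffop P Q R v' $$ k = 0" if "k < n - 1 + int (Suc j)" for k
    proof -
      have eq: "diffop P Q R v' $$ k = diffop P Q R v $$ k + a * diffop P Q R u $$ k"
        by (simp add: v'_def diffop_linear)
      show ?thesis
      proof (cases "k = m")
        case True
        then show ?thesis using eq d by (simp add: a_def flip: d_def)
      next
        case False
        then have "k < m" using that by (simp add: m_def)
        then show ?thesis
          using eq v(4)[of k] diffop_leading(1)[of 2 P Q R "m + 2" u k, OF fuchsian u(3)] by (simp add: m_def)
      qed
    qed
    ultimately show ?thesis using v(2,3) by (intro bexI[of _ v']) auto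
  qed
qed

end


text \<open>
  Multiplying the equation by the square of the local variable reduces it to power series.
  In terms of \<open>z\<close>, the coefficients become \<open>(z - \<zeta>)\<^sup>2 P\<close>, \<open>(z - \<zeta>) * ((z - \<zeta>) Q)\<close> and \<open>(z - \<zeta>)\<^sup>2 R\<close>,
  of which \<open>P\<close>, \<open>(z - \<zeta>) Q\<close> and \<open>(z - \<zeta>)\<^sup>2 R\<close> are holomorphic at \<open>\<zeta>\<close>.
\<close>

lemma frobenius_solution_laurent:
  assumes conv: "fls_conv_radius P > 0" "fls_conv_radius Q > 0" "fls_conv_radius R > 0"
      "fls_conv_radius g > 0"
    and low: "lowers_orders_by 2 P Q R" and P0: "P $$ 0 \<noteq> 0"
    and N: "N \<ge> 0" "\<And>n. n > N \<Longrightarrow> poly (indicial_poly 2 P Q R) (of_int n) \<noteq> 0"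
    and g: "\<And>k. k \<le> N - 2 \<Longrightarrow> g $$ k = 0"
  obtains W where "fls_conv_radius W > 0" "\<And>k. k \<le> N \<Longrightarrow> W $$ k = 0" "diffop P Q R W = g"
proof -
  have conv_X: "fls_conv_radius (fls_X ^ n * F) > 0" if "fls_conv_radius F > 0" for n F
    using that by (simp add: fls_X_power_times_conv_shift)
  define A B C H where "A = fls_regpart P" and "B = fls_regpart (fls_X * Q)"
    and "C = fls_regpart (fls_X\<^sup>2 * R)" and "H = fls_regpart (fls_X\<^sup>2 * g)"
  have shift1: "(fls_X * F) $$ k = F $$ (k - 1)" and shift2: "(fls_X\<^sup>2 * F) $$ k = F $$ (k - 2)"
    for F :: "complex fls" and k
    by (simp_all add: fls_X_times_conv_shift fls_X_power_times_conv_shift)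
  have to_fls: "fps_to_fls (fls_regpart F) = F" if "\<And>k. k < 0 \<Longrightarrow> F $$ k = 0" for F :: "complex fls"
    using that by (intro fls_regpart_to_fls_trivial fls_subdegree_ge0I)
  have A: "fps_to_fls A = P" and B: "fps_to_fls B = fls_X * Q"
    and C: "fps_to_fls C = fls_X\<^sup>2 * R"
    unfolding A_def B_def C_def
    using low by (auto intro!: to_fls simp: lowers_orders_by_def shift1 shift2)
  have Hn: "fps_to_fls H = fls_X\<^sup>2 * g"
    unfolding H_def using g N by (intro to_fls) (simp add: shift2)
  have rad: "fps_conv_radius A > 0" "fps_conv_radius B > 0"
      "fps_conv_radius C > 0" "fps_conv_radius H > 0"
    using conv conv_X[of Q 1] conv_X[of R 2] conv_X[of g 2]
    by (simp_all add: A_def B_def C_def H_def fps_conv_radius_fls_regpart)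
  have nonres: "of_nat n * (of_nat n - 1) * A $ 0 + of_nat n * B $ 0 + C $ 0 \<noteq> 0" if "n > nat N" for n
  proof -
    have "poly (indicial_poly 2 P Q R) (of_int (int n)) \<noteq> 0" using that N by (intro N(2)) auto
    then show ?thesis
      by (simp add: indicial_poly_def A_def B_def C_def shift1 shift2 del: fls_X_power_times_conv_shift)
        (simp add: algebra_simps)
  qed
  have H0: "H $ n = 0" if "n \<le> nat N" for n
    using that N(1) g[of "int n - 2"] by (simp add: H_def shift2)
  obtain W where W: "fps_conv_radius W > 0" "\<And>n. n \<le> nat N \<Longrightarrow> W $ n = 0"
    "A * (fps_X\<^sup>2 * fps_deriv (fps_deriv W)) + B * (fps_X * fps_deriv W) + C * W = H"
    using frobenius_solution_fps[OF rad _ nonres H0] P0 by (auto simp: A_def)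
  show ?thesis
  proof
    show "fls_conv_radius (fps_to_fls W) > 0" using W(1) by simp
    show "fps_to_fls W $$ k = 0" if "k \<le> N" for k
      using that W(2)[of "nat k"] by (auto simp: nat_le_iff)
    have "fls_X\<^sup>2 * diffop P Q R (fps_to_fls W) = fps_to_fls
        (A * (fps_X\<^sup>2 * fps_deriv (fps_deriv W)) + B * (fps_X * fps_deriv W) + C * W)"
      by (simp add: diffop_def fls_times_fps_to_fls A B C fls_deriv_fps_to_fls fps_to_fls_power
          algebra_simps power2_eq_square)
    also have "\<dots> = fls_X\<^sup>2 * g" by (simp only: W(3) Hn)
    finally show "diffop P Q R (fps_to_fls W) = g" by simp
  qed
qed

text \<open>
  One solution for each of the exponents \<open>M < N\<close>: an approximate solution in \<open>V\<close>, corrected by a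
  convergent series of order greater than \<open>N\<close>, which does not affect the leading term.
\<close>

lemma (in stable_laurent_space) two_convergent_solutions:
  assumes conv: "fls_conv_radius P > 0" "fls_conv_radius Q > 0" "fls_conv_radius R > 0"
    and V: "\<And>F. F \<in> V \<Longrightarrow> fls_conv_radius F > 0"
  obtains F G where "fls_conv_radius F > 0" "fls_conv_radius G > 0"
    "diffop P Q R F = 0" "diffop P Q R G = 0"
    "\<And>a b. fls_const a * F + fls_const b * G = 0 \<Longrightarrow> a = 0 \<and> b = 0"
proof -
  obtain M N where MN: "M \<in> orders" "N \<in> orders" "M < N"
    "\<And>n. poly (indicial_poly 2 P Q R) (of_int n) = 0 \<longleftrightarrow> n = M \<or> n = N"
    "\<And>k. k > 0 \<Longrightarrow> M - 2 * k \<notin> orders" "\<And>k. k > 0 \<Longrightarrow> N - 2 * k \<notin> orders"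
    using indicial_exponents by blast
  have root: "n - 2 * k \<notin> orders" if "poly (indicial_poly 2 P Q R) (of_int n) = 0" "k > 0" for n k
    using that MN by auto
  have N0: "N \<ge> 0" using MN orders_nonneg by auto
  have sol: "\<exists>F. fls_conv_radius F > 0 \<and> diffop P Q R F = 0 \<and> F $$ n \<noteq> 0 \<and> (\<forall>k<n. F $$ k = 0)"
    if n: "n \<in> {M, N}" for n
  proof -
    obtain v where v: "v \<in> V" "v $$ n \<noteq> 0" "\<And>k. k < n \<Longrightarrow> v $$ k = 0"
      "\<And>k. k < n - 1 + int (nat (N - n)) \<Longrightarrow> diffop P Q R v $$ k = 0"
      using approximate_solution[OF _ _ root, of n "nat (N - n)"] n MN by blast
    have "diffop P Q R v $$ k = 0" if "k \<le> N - 2" for k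
      using v(4)[of k] that n MN(3) by auto
    then obtain W where W: "fls_conv_radius W > 0" "\<And>k. k \<le> N \<Longrightarrow> W $$ k = 0"
      "diffop P Q R W = diffop P Q R v"
      using frobenius_solution_laurent[OF conv V[OF stable[OF v(1)]] fuchsian P_nonzero N0] MN by force
    have "fls_conv_radius (v - W) > 0"
      using fls_conv_radius_diff[of v W] V[OF v(1)] W(1) by (meson less_le_trans min_less_iff_conj)
    moreover have "diffop P Q R (v - W) = 0"
      using diffop_linear[of P Q R v "-1" W] W(3) by simp
    moreover have "(v - W) $$ k = v $$ k" if "k \<le> n" for k
      using that W(2)[of k] n MN(3) by auto
    ultimately show ?thesis using v(2,3) by (intro exI[of _ "v - W"]) auto
  qed
  obtain F where F: "fls_conv_radius F > 0" "diffop P Q R F = 0" "F $$ M \<noteq> 0" "\<forall>k<M. F $$ k = 0"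
    using sol[of M] by auto
  obtain G where G: "fls_conv_radius G > 0" "diffop P Q R G = 0" "G $$ N \<noteq> 0" "\<forall>k<N. G $$ k = 0"
    using sol[of N] by auto
  show ?thesis
  proof (rule that[OF F(1) G(1) F(2) G(2)])
    fix a b assume eq: "fls_const a * F + fls_const b * G = 0"
    have "(fls_const a * F + fls_const b * G) $$ M = 0" by (simp add: eq)
    then have "a = 0" using F(3) G(4) MN(3) by simp
    moreover have "(fls_const a * F + fls_const b * G) $$ N = 0" by (simp add: eq)
    ultimately show "a = 0 \<and> b = 0" using G(3) by simp
  qed
qed

section \<open>Trivial monodromy\<close>

theorem proposition5p21:
  fixes p q r :: "complex poly fract" and \<zeta> :: complex
  assumes "exceptional p q r"
    and "ratfun_eval p \<zeta> \<noteq> 0"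
  shows "trivial_monodromy p q r \<zeta>"
proof -
  let ?P = "ratfun_laurent \<zeta> p" and ?Q = "ratfun_laurent \<zeta> q" and ?R = "ratfun_laurent \<zeta> r"
  define E where "E = {y. \<exists>c. op_poly p q r y = to_fract (smult c y)}"
  define U where "U = poly_space.span E"
  define V where "V = poly_laurent \<zeta> ` U"
  have op: "op_laurent p q r \<zeta> = diffop ?P ?Q ?R"
    by (simp add: fun_eq_iff op_laurent_def diffop_def)
  obtain K where K: "finite K" "\<And>k. k \<notin> K \<Longrightarrow> has_eigenpoly p q r k"
    using assms(1) by (auto simp: exceptional_def)
  have degrees: "\<exists>u\<in>U. u \<noteq> 0 \<and> degree u = k" if "k \<notin> K" for k
  proof -
    obtain y c where y: "y \<noteq> 0" "degree y = k" "op_poly p q r y = to_fract (smult c y)"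
      using K(2)[OF \<open>k \<notin> K\<close>] unfolding has_eigenpoly_def by blast
    then have "y \<in> U" unfolding U_def E_def by (blast intro: poly_space.span_base)
    then show ?thesis using y by blast
  qed
  interpret stable_laurent_space ?P ?Q ?R V
  proof
    fix F G a assume "F \<in> V" "G \<in> V"
    then obtain f g where "f \<in> U" "g \<in> U" "F = poly_laurent \<zeta> f" "G = poly_laurent \<zeta> g"
      by (auto simp: V_def)
    moreover from this have "f + smult a g \<in> U"
      unfolding U_def by (intro poly_space.span_add poly_space.span_scale)
    ultimately show "F + fls_const a * G \<in> V"
      unfolding V_def by (metis image_eqI poly_laurent_add poly_laurent_smult)
  next
    fix F assume "F \<in> V"
    then obtain f where f: "f \<in> U" "F = poly_laurent \<zeta> f" by (auto simp: V_def)
    then obtain w where "w \<in> U" "op_poly p q r f = to_fract w"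
      using eigenspan_stable unfolding U_def E_def by blast
    then show "diffop ?P ?Q ?R F \<in> V"
      using op_laurent_poly_laurent[of p q r f w \<zeta>] f by (simp add: op V_def)
  next
    fix F assume "F \<in> V" "F \<noteq> 0"
    then show "fls_subdegree F \<ge> 0" by (auto simp: V_def poly_laurent_def fls_subdegree_fls_to_fps_gt0)
  next
    have "fls_subdegree ` (V - {0}) = int ` order \<zeta> ` (U - {0})"
    proof -
      have "V - {0} = poly_laurent \<zeta> ` (U - {0})" by (auto simp: V_def)
      then show ?thesis by (auto simp: image_image subdegree_poly_laurent intro!: image_cong)
    qed
    moreover have "{0..} - int ` order \<zeta> ` (U - {0}) \<subseteq> int ` (- order \<zeta> ` (U - {0}))"
    proof
      fix n assume n: "n \<in> {0..} - int ` order \<zeta> ` (U - {0})"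
      then have "n = int (nat n)" by simp
      then show "n \<in> int ` (- order \<zeta> ` (U - {0}))" using n by blast
    qed
    moreover have "finite (- order \<zeta> ` (U - {0}))"
      by (rule finite_missing_orders[OF K(1) _ degrees]) (simp_all add: U_def)
    ultimately show "finite ({0..} - fls_subdegree ` (V - {0}))"
      by (metis finite_imageI finite_subset)
  qed (use ratfun_laurent_regular[OF assms(2)] in auto)
  have conv: "fls_conv_radius (ratfun_laurent \<zeta> f) > 0" for f
    using ratfun_laurent_expansion[of f \<zeta>] by (simp add: has_laurent_expansion_def)
  have "fls_conv_radius F > 0" if "F \<in> V" for F
    using that by (auto simp: V_def poly_laurent_def)
  from two_convergent_solutions[OF conv conv conv this] obtain F G where
    "fls_conv_radius F > 0" "fls_conv_radius G > 0"
    "diffop ?P ?Q ?R F = 0" "diffop ?P ?Q ?R G = 0"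
    "\<And>a b. fls_const a * F + fls_const b * G = 0 \<Longrightarrow> a = 0 \<and> b = 0"
    by metis
  then show ?thesis
    unfolding trivial_monodromy_def laurent_solution_def op by blast
qed

end
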